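(* If an LQG game $\mathcal G=(w,b,c,\mathcal P)$ has an affine equilibrium $\bar\varphi$, then there exist some canonical information structure $\mathcal P^*$ and an affine equilibrium $\bar\varphi^*$ in $\mathcal G^*=(w,b,c,\mathcal P^* )$ such that the induced outcomes of $(\mathcal G,\bar\varphi)$ and $(\mathcal G^*,\bar\varphi^* )$ coincide (have the same distribution as Gaussian processes).
   Context: Fix $\mu_\theta\in\mathbb R$ and $\sigma_\theta>0$. Agents are indexed by $[0,1]$ with Lebesgue measure. Payoff structure: $(w,b,c)$ with $w:[0,1]^2\to\mathbb R$ and $b,c:[0,1]\to\mathbb R$ square-integrable ($\int_0^1\int_0^1|w|^2<\infty$, $\int_0^1|b|^2<\infty$, $\int_0^1|c|^2<\infty$), otherwise unrestricted. Information structure: $\{\theta\}\cup\{S_1(i),\dots,S_{\bar d}(i)\}_{i\in[0,1]}$ is a Gaussian process (finite subcollections multivariate normal, possibly degenerate) with $\theta\sim\mathcal N(\mu_\theta,\sigma_\theta^2)$; $S(i)=(S_1(i),\dots,S_{\bar d}(i))^\top$, $m(i)=\mathbb E[S(i)]$, $K(i,j)=\mathrm{Cov}[S(i),S(j)]$, $K_\theta(i)=\mathrm{Cov}[S(i),\theta]$, $K(i,i)$ invertible for every $i$; $P(i,j)=K(i,i)^{-1/2}K(i,j)K(j,j)^{-1/2}$ and $P_\theta(i)=\sigma_\theta^{-1}K(i,i)^{-1/2}K_\theta(i)$ (symmetric square roots), with each coordinate of $P$ and $P_\theta$ assumed measurable as a function of the agent index $i\in[0,1]$. Write $\mathcal P=(P,P_\theta)$.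 An affine equilibrium of $(w,b,c,\mathcal P)$ is $\bar\varphi=(\varphi_0,\varphi):[0,1]\to\mathbb R\times\mathbb R^{\bar d}$ with square-integrable components such that for every $i$: $\varphi_0(i)=\int_0^1w(i,j)\varphi_0(j)\,dj+\mu_\theta b(i)+c(i)$ and $\varphi(i)=\int_0^1w(i,j)P(i,j)\varphi(j)\,dj+\sigma_\theta b(i)P_\theta(i)$. Its induced outcome is $\{\theta\}\cup\{X(i)\}_{i\in[0,1]}$ with $X(i)=\varphi_0(i)+\varphi(i)^\top K(i,i)^{-1/2}(S(i)-m(i))$. Canonical information structure: the case $\bar d=1$ with $S^*(i)=h(i)\theta+\varepsilon(i)$, $\mathrm{Var}[S^*(i)]=1$, where $h:[0,1]\to[0,\infty)$, $g:[0,1]^2\to\mathbb R$, and $\{\theta\}\cup\{\varepsilon(i)\}_{i\in[0,1]}$ is a Gaussian process with $\mathbb E[\varepsilon(i)]=0$, $\mathrm{Cov}[\varepsilon(i),\theta]=0$, $\mathrm{Cov}[\varepsilon(i),\varepsilon(j)]=g(i,j)$; so $P(i,j)=\sigma_\theta^2h(i)h(j)+g(i,j)$ and $P_\theta(i)=\sigma_\theta h(i)$. *)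

theory Defs
  imports "HOL-Probability.Probability"
begin

abbreviation agents :: "real set" where
  "agents \<equiv> {0..1}"

section \<open>Payoff structures\<close>

definition square_integrable_on :: "('b::euclidean_space \<Rightarrow> real) \<Rightarrow> 'b set \<Rightarrow> bool" where
  "square_integrable_on f A \<longleftrightarrow>
     f \<in> borel_measurable (lebesgue_on A) \<and> integrable (lebesgue_on A) (\<lambda>x. (f x)\<^sup>2)"

definition payoff_structure ::
  "(real \<Rightarrow> real \<Rightarrow> real) \<Rightarrow> (real \<Rightarrow> real) \<Rightarrow> (real \<Rightarrow> real) \<Rightarrow> bool" where
  "payoff_structure w b c \<longleftrightarrow>
     square_integrable_on (\<lambda>(i, j). w i j) (agents \<times> agents) \<and>
     square_integrable_on b agents \<and>
     square_integrable_on c agents"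

section \<open>Gaussian processes\<close>

text \<open>Univariate normal, where a variance of zero (a point mass) is allowed.\<close>

definition gaussian_rv :: "'a measure \<Rightarrow> ('a \<Rightarrow> real) \<Rightarrow> bool" where
  "gaussian_rv M X \<longleftrightarrow>
     X \<in> borel_measurable M \<and>
     (\<exists>\<mu>. (AE \<omega> in M. X \<omega> = \<mu>) \<or> (\<exists>\<sigma>>0. distributed M lborel X (normal_density \<mu> \<sigma>)))"

text \<open>A finite family is multivariate normal, possibly degenerate, iff all its linear
  combinations are univariate normal, possibly degenerate.\<close>

definition gaussian_process :: "'a measure \<Rightarrow> 't set \<Rightarrow> ('t \<Rightarrow> 'a \<Rightarrow> real) \<Rightarrow> bool" where
  "gaussian_process M I X \<longleftrightarrow>
     prob_space M \<and>
     (\<forall>F a. finite F \<and> F \<subseteq> I \<longrightarrow> gaussian_rv M (\<lambda>\<omega>. \<Sum>t\<in>F. a t * X t \<omega>))"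

text \<open>The collection consisting of \<open>\<theta>\<close> (index \<open>None\<close>) and of all \<open>Y u\<close> with \<open>u \<in> I\<close>.\<close>

definition gaussian_with_state ::
  "'a measure \<Rightarrow> ('a \<Rightarrow> real) \<Rightarrow> 'u set \<Rightarrow> ('u \<Rightarrow> 'a \<Rightarrow> real) \<Rightarrow> bool" where
  "gaussian_with_state M \<theta> I Y \<longleftrightarrow>
     gaussian_process M (insert None (Some ` I)) (case_option \<theta> Y)"

definition cov :: "'a measure \<Rightarrow> ('a \<Rightarrow> real) \<Rightarrow> ('a \<Rightarrow> real) \<Rightarrow> real" where
  "cov M X Y =
     prob_space.expectation M
       (\<lambda>\<omega>. (X \<omega> - prob_space.expectation M X) * (Y \<omega> - prob_space.expectation M Y))"

section \<open>Information structures\<close>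

text \<open>The signal of agent \<open>i\<close> is the random vector \<open>S i :: 'a \<Rightarrow> real^'d\<close>; the number of
  coordinates is \<open>CARD('d)\<close>.\<close>

definition sig_mean :: "'a measure \<Rightarrow> (real \<Rightarrow> 'a \<Rightarrow> real^'d) \<Rightarrow> real \<Rightarrow> real^'d" where
  "sig_mean M S i = (\<chi> k. prob_space.expectation M (\<lambda>\<omega>. S i \<omega> $ k))"

definition sig_cov :: "'a measure \<Rightarrow> (real \<Rightarrow> 'a \<Rightarrow> real^'d) \<Rightarrow> real \<Rightarrow> real \<Rightarrow> real^'d^'d" where
  "sig_cov M S i j = (\<chi> k l. cov M (\<lambda>\<omega>. S i \<omega> $ k) (\<lambda>\<omega>. S j \<omega> $ l))"

definition sig_state_cov ::
  "'a measure \<Rightarrow> ('a \<Rightarrow> real) \<Rightarrow> (real \<Rightarrow> 'a \<Rightarrow> real^'d) \<Rightarrow> real \<Rightarrow> real^'d" where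
  "sig_state_cov M \<theta> S i = (\<chi> k. cov M (\<lambda>\<omega>. S i \<omega> $ k) \<theta>)"

text \<open>The symmetric positive semidefinite square root of a symmetric positive semidefinite
  matrix; \<open>THE\<close> is legitimate since it exists and is unique for such matrices.\<close>

definition matrix_sqrt :: "real^'d^'d \<Rightarrow> real^'d^'d" where
  "matrix_sqrt A =
     (THE B. transpose B = B \<and> (\<forall>x. 0 \<le> x \<bullet> (B *v x)) \<and> B ** B = A)"

definition whiten :: "'a measure \<Rightarrow> (real \<Rightarrow> 'a \<Rightarrow> real^'d) \<Rightarrow> real \<Rightarrow> real^'d^'d" where
  "whiten M S i = matrix_inv (matrix_sqrt (sig_cov M S i i))"

definition corr :: "'a measure \<Rightarrow> (real \<Rightarrow> 'a \<Rightarrow> real^'d) \<Rightarrow> real \<Rightarrow> real \<Rightarrow> real^'d^'d" where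
  "corr M S i j = whiten M S i ** sig_cov M S i j ** whiten M S j"

definition state_corr ::
  "real \<Rightarrow> 'a measure \<Rightarrow> ('a \<Rightarrow> real) \<Rightarrow> (real \<Rightarrow> 'a \<Rightarrow> real^'d) \<Rightarrow> real \<Rightarrow> real^'d" where
  "state_corr \<sigma>\<^sub>\<theta> M \<theta> S i = (1 / \<sigma>\<^sub>\<theta>) *\<^sub>R (whiten M S i *v sig_state_cov M \<theta> S i)"

definition info_structure ::
  "real \<Rightarrow> real \<Rightarrow> 'a measure \<Rightarrow> ('a \<Rightarrow> real) \<Rightarrow> (real \<Rightarrow> 'a \<Rightarrow> real^'d) \<Rightarrow> bool" where
  "info_structure \<mu>\<^sub>\<theta> \<sigma>\<^sub>\<theta> M \<theta> S \<longleftrightarrow>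
     gaussian_with_state M \<theta> (agents \<times> (UNIV :: 'd set)) (\<lambda>(i, k) \<omega>. S i \<omega> $ k) \<and>
     distributed M lborel \<theta> (normal_density \<mu>\<^sub>\<theta> \<sigma>\<^sub>\<theta>) \<and>
     (\<forall>i\<in>agents. invertible (sig_cov M S i i)) \<and>
     (\<forall>k l. (\<lambda>(i, j). corr M S i j $ k $ l) \<in> borel_measurable (lebesgue_on (agents \<times> agents))) \<and>
     (\<forall>k. (\<lambda>i. state_corr \<sigma>\<^sub>\<theta> M \<theta> S i $ k) \<in> borel_measurable (lebesgue_on agents))"

definition canonical_info_structure ::
  "real \<Rightarrow> real \<Rightarrow> 'a measure \<Rightarrow> ('a \<Rightarrow> real) \<Rightarrow> (real \<Rightarrow> 'a \<Rightarrow> real^1) \<Rightarrow> bool" where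
  "canonical_info_structure \<mu>\<^sub>\<theta> \<sigma>\<^sub>\<theta> M \<theta> S \<longleftrightarrow>
     info_structure \<mu>\<^sub>\<theta> \<sigma>\<^sub>\<theta> M \<theta> S \<and>
     (\<exists>(h :: real \<Rightarrow> real) (g :: real \<Rightarrow> real \<Rightarrow> real) (\<epsilon> :: real \<Rightarrow> 'a \<Rightarrow> real).
        (\<forall>i\<in>agents. 0 \<le> h i) \<and>
        gaussian_with_state M \<theta> agents \<epsilon> \<and>
        (\<forall>i\<in>agents. prob_space.expectation M (\<epsilon> i) = 0) \<and>
        (\<forall>i\<in>agents. cov M (\<epsilon> i) \<theta> = 0) \<and>
        (\<forall>i\<in>agents. \<forall>j\<in>agents. cov M (\<epsilon> i) (\<epsilon> j) = g i j) \<and>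
        (\<forall>i\<in>agents. \<forall>\<omega>\<in>space M. S i \<omega> $ 1 = h i * \<theta> \<omega> + \<epsilon> i \<omega>) \<and>
        (\<forall>i\<in>agents. prob_space.variance M (\<lambda>\<omega>. S i \<omega> $ 1) = 1))"

section \<open>Affine equilibria and their outcomes\<close>

text \<open>Integrability is stated explicitly because the integral of a non-integrable function
  is zero by convention.\<close>

definition affine_equilibrium ::
  "real \<Rightarrow> real \<Rightarrow> (real \<Rightarrow> real \<Rightarrow> real) \<Rightarrow> (real \<Rightarrow> real) \<Rightarrow> (real \<Rightarrow> real) \<Rightarrow>
   (real \<Rightarrow> real \<Rightarrow> real^'d^'d) \<Rightarrow> (real \<Rightarrow> real^'d) \<Rightarrow>
   (real \<Rightarrow> real) \<Rightarrow> (real \<Rightarrow> real^'d) \<Rightarrow> bool" where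
  "affine_equilibrium \<mu>\<^sub>\<theta> \<sigma>\<^sub>\<theta> w b c P P\<^sub>\<theta> \<phi>\<^sub>0 \<phi> \<longleftrightarrow>
     square_integrable_on \<phi>\<^sub>0 agents \<and>
     (\<forall>k. square_integrable_on (\<lambda>i. \<phi> i $ k) agents) \<and>
     (\<forall>i\<in>agents.
        integrable (lebesgue_on agents) (\<lambda>j. w i j * \<phi>\<^sub>0 j) \<and>
        \<phi>\<^sub>0 i = (LINT j|lebesgue_on agents. w i j * \<phi>\<^sub>0 j) + \<mu>\<^sub>\<theta> * b i + c i \<and>
        integrable (lebesgue_on agents) (\<lambda>j. w i j *\<^sub>R (P i j *v \<phi> j)) \<and>
        \<phi> i = (LINT j|lebesgue_on agents. w i j *\<^sub>R (P i j *v \<phi> j)) + (\<sigma>\<^sub>\<theta> * b i) *\<^sub>R P\<^sub>\<theta> i)"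

definition outcome ::
  "'a measure \<Rightarrow> (real \<Rightarrow> 'a \<Rightarrow> real^'d) \<Rightarrow> (real \<Rightarrow> real) \<Rightarrow> (real \<Rightarrow> real^'d) \<Rightarrow>
   real \<Rightarrow> 'a \<Rightarrow> real" where
  "outcome M S \<phi>\<^sub>0 \<phi> i \<omega> = \<phi>\<^sub>0 i + \<phi> i \<bullet> (whiten M S i *v (S i \<omega> - sig_mean M S i))"

text \<open>The joint law of the state and the action profile on the product space
  \<open>\<real> \<times> \<real>\<^bsup>[0,1]\<^esup>\<close>.\<close>

definition outcome_law ::
  "'a measure \<Rightarrow> ('a \<Rightarrow> real) \<Rightarrow> (real \<Rightarrow> 'a \<Rightarrow> real) \<Rightarrow> (real \<times> (real \<Rightarrow> real)) measure" where
  "outcome_law M \<theta> X =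
     distr M (borel \<Otimes>\<^sub>M (\<Pi>\<^sub>M i\<in>agents. borel)) (\<lambda>\<omega>. (\<theta> \<omega>, \<lambda>i\<in>agents. X i \<omega>))"

end

theory Submission
  imports Defs
begin

text \<open>Write \<open>Z i\<close> for the whitened signal \<open>whiten M S i *v (S i - m i)\<close>, whose covariance matrix is
  the identity.  Agent \<open>i\<close> uses only the scalar \<open>\<phi> i \<bullet> Z i\<close>, so write \<open>\<phi> i = (v i \<bullet> \<phi> i) v i\<close> for a
  measurable field of unit vectors \<open>v i\<close> and let the canonical signal be \<open>v i \<bullet> Z i\<close>, which has
  variance one, shifted by a constant so that subtracting \<open>h i * \<theta>\<close> leaves mean-zero noise.  The free sign
  of \<open>v i\<close> makes the loading \<open>h i = v i \<bullet> P\<^sub>\<theta> i / \<sigma>\<^sub>\<theta>\<close> nonnegative.  Taking the inner product of the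
  equilibrium equation with \<open>v i\<close> gives the scalar equation for the coefficients \<open>v i \<bullet> \<phi> i\<close>,
  and the new actions equal the old ones pointwise on the same probability space.\<close>

section \<open>Square roots of positive semidefinite matrices\<close>

text \<open>Maximise the Rayleigh quotient over the compact unit sphere of \<open>V\<close>. For a
  maximiser \<open>u\<close> with value \<open>l\<close>, the residual
  \<open>r = f u - l *\<^sub>R u\<close> is orthogonal to \<open>u\<close>, and a small move from
  \<open>u\<close> along \<open>r\<close> would raise the quotient unless \<open>r = 0\<close>.
  Staying inside an invariant subspace prepares an induction on dimension.\<close>

lemma self_adjoint_eigenvector:
  fixes f :: "'a::euclidean_space \<Rightarrow> 'a"
  assumes f: "linear f" and adj: "\<And>x y. f x \<bullet> y = x \<bullet> f y"
    and V: "subspace V" "f ` V \<subseteq> V" and ne: "\<exists>x\<in>V. x \<noteq> 0"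
  shows "\<exists>u\<in>V. norm u = 1 \<and> f u = (u \<bullet> f u) *\<^sub>R u"
proof -
  let ?K = "V \<inter> sphere 0 1"
  have "compact ?K"
    by (simp add: closed_Int_compact closed_subspace V)
  moreover obtain x0 where "x0 \<in> V" "x0 \<noteq> 0" using ne by blast
  then have "x0 /\<^sub>R norm x0 \<in> ?K" by (simp add: V subspace_scale)
  then have "?K \<noteq> {}" by blast
  moreover have "continuous_on ?K (\<lambda>x. x \<bullet> f x)"
    using f by (intro continuous_intros linear_continuous_on) (simp add: linear_linear)
  ultimately obtain u where u: "u \<in> ?K" and max: "\<And>x. x \<in> ?K \<Longrightarrow> x \<bullet> f x \<le> u \<bullet> f u"
    by (metis continuous_attains_sup)
  define l where "l = u \<bullet> f u"
  \<comment> \<open>A maximiser of the Rayleigh quotient on the unit sphere of \<open>V\<close> is an eigenvector.\<close>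
  have quad: "x \<bullet> f x \<le> l * (x \<bullet> x)" if "x \<in> V" for x
  proof (cases "x = 0")
    case False
    have "x /\<^sub>R norm x \<in> ?K" using False that by (simp add: V subspace_scale)
    from max[OF this] have "(x \<bullet> f x) / (norm x)\<^sup>2 \<le> l"
      by (simp add: linear_scale[OF f] l_def power2_eq_square divide_simps)
    then show ?thesis using False by (simp add: divide_simps power2_norm_eq_inner)
  qed (simp add: linear_0[OF f])
  have uV: "u \<in> V" and uu: "u \<bullet> u = 1" using u by (auto simp: norm_eq_1)
  define r where "r = f u - l *\<^sub>R u"
  have rV: "r \<in> V" unfolding r_def using V uV by (auto intro!: subspace_diff subspace_scale)
  have ru: "r \<bullet> u = 0" using uu by (simp add: r_def inner_diff_left l_def inner_commute[of "f u" u])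
  have rf: "r \<bullet> f u = r \<bullet> r"
  proof -
    have "f u = r + l *\<^sub>R u" by (simp add: r_def)
    then show ?thesis using ru by (simp add: inner_add_right)
  qed
  \<comment> \<open>Inserting \<open>u + t *\<^sub>R r\<close> into \<open>quad\<close> and
    cancelling the constant terms bounds a gain linear in \<open>t\<close> by a term quadratic in
    \<open>t\<close>; self-adjointness makes both cross terms equal to
    \<open>r \<bullet> r\<close>.\<close>
  have main: "2 * t * (r \<bullet> r) \<le> t\<^sup>2 * (l * (r \<bullet> r) - r \<bullet> f r)" for t
  proof -
    have "u + t *\<^sub>R r \<in> V" using V uV rV by (simp add: subspace_add subspace_scale)
    from quad[OF this]
    have "l + t * (r \<bullet> f u) + t * (u \<bullet> f r) + t\<^sup>2 * (r \<bullet> f r) \<le> l * (1 + t\<^sup>2 * (r \<bullet> r))"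
      using ru by (simp add: linear_add[OF f] linear_scale[OF f] inner_add_left inner_add_right
          uu l_def[symmetric] inner_commute[of u r] power2_eq_square algebra_simps)
    moreover have "u \<bullet> f r = r \<bullet> r" using adj[of u r] rf by (simp add: inner_commute)
    ultimately show ?thesis using rf by (simp add: algebra_simps)
  qed
  have "r \<bullet> r = 0"
  proof (rule ccontr)
    assume "r \<bullet> r \<noteq> 0"
    then have p: "r \<bullet> r > 0" using inner_ge_zero[of r] by linarith
    define C where "C = l * (r \<bullet> r) - r \<bullet> f r"
    have C: "C \<ge> 0" using quad[OF rV] by (simp add: C_def)
    \<comment> \<open>This choice of \<open>t\<close> reduces \<open>main\<close> to
      \<open>2 * (C + 1) \<le> C\<close>, impossible for \<open>C \<ge> 0\<close>; the added 1 keeps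
      the denominator positive when \<open>C = 0\<close>.\<close>
    have "2 * ((r \<bullet> r) / (C + 1)) * (r \<bullet> r) \<le> ((r \<bullet> r) / (C + 1))\<^sup>2 * C"
      using main[of "(r \<bullet> r) / (C + 1)"] unfolding C_def .
    then have "(r \<bullet> r)\<^sup>2 * (2 * (C + 1)) \<le> (r \<bullet> r)\<^sup>2 * C"
      using C by (simp add: divide_simps power2_eq_square split: if_splits) (simp add: algebra_simps)
    then show False using p C by (simp add: mult_le_cancel_left)
  qed
  then have "f u = l *\<^sub>R u" by (simp add: r_def)
  then show ?thesis using u unfolding l_def by auto
qed

text \<open>The spectral theorem on an invariant subspace, by induction on its dimension. Once a
  unit eigenvector \<open>u\<close> is split off, self-adjointness makes the orthogonal complement
  of \<open>u\<close> in \<open>V\<close> invariant, and its dimension is one less.\<close>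

lemma self_adjoint_orthonormal_eigenbasis:
  fixes f :: "'a::euclidean_space \<Rightarrow> 'a"
  assumes f: "linear f" and adj: "\<And>x y. f x \<bullet> y = x \<bullet> f y"
  shows "\<lbrakk>subspace V; f ` V \<subseteq> V\<rbrakk> \<Longrightarrow>
    \<exists>B. finite B \<and> (\<forall>x\<in>B. \<forall>y\<in>B. x \<bullet> y = (if x = y then 1 else 0)) \<and> span B = V \<and>
      (\<forall>x\<in>B. f x = (x \<bullet> f x) *\<^sub>R x)"
proof (induction "dim V" arbitrary: V)
  case 0
  then have "V = {0}" using subspace_0 dim_eq_0 by (metis singletonD subset_singletonD empty_iff)
  then show ?case by (intro exI[of _ "{}"]) auto
next
  case (Suc n)
  then have "\<exists>x\<in>V. x \<noteq> 0" by (metis dim_eq_0 nat.distinct(1) singletonI subsetI)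
  then obtain u where u: "u \<in> V" "norm u = 1" "f u = (u \<bullet> f u) *\<^sub>R u"
    using self_adjoint_eigenvector[OF f adj Suc.prems] by blast
  have uu: "u \<bullet> u = 1" using u by (simp add: norm_eq_1)
  define U where "U = {y \<in> V. u \<bullet> y = 0}"
  have U: "subspace U" using Suc.prems(1) unfolding U_def subspace_def
    by (auto simp: inner_add_right)
  have fU: "f ` U \<subseteq> U"
  proof
    fix z assume "z \<in> f ` U"
    then obtain y where y: "y \<in> U" "z = f y" by blast
    have "u \<bullet> f y = (u \<bullet> f u) * (u \<bullet> y)"
      by (metis adj inner_scaleR_left u(3))
    then show "z \<in> U" using y Suc.prems by (auto simp: U_def)
  qed
  have "U = {y \<in> V. \<forall>x\<in>span {u}. orthogonal x y}"
    by (auto simp: U_def orthogonal_def span_singleton)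
  moreover have "span {u} \<subseteq> V" using u Suc.prems(1) by (simp add: span_minimal)
  ultimately have "dim U + dim (span {u}) = dim V"
    using dim_subspace_orthogonal_to_vectors[OF subspace_span Suc.prems(1), of "{u}"] by simp
  moreover have "dim (span {u}) = 1" using uu by (auto simp: dim_span dim_singleton)
  ultimately have "n = dim U" using Suc.hyps(2) by simp
  from Suc.hyps(1)[OF this U fU] obtain B where B: "finite B"
    "\<And>x y. x \<in> B \<Longrightarrow> y \<in> B \<Longrightarrow> x \<bullet> y = (if x = y then 1 else 0)" "span B = U"
    "\<And>x. x \<in> B \<Longrightarrow> f x = (x \<bullet> f x) *\<^sub>R x" by auto
  have BU: "x \<in> V" "u \<bullet> x = 0" "x \<bullet> u = 0" if "x \<in> B" for x
    using that B(3) span_base[of x B] by (auto simp: U_def inner_commute)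
  have "span (insert u B) = V"
  proof
    show "span (insert u B) \<subseteq> V" using BU u Suc.prems(1) by (intro span_minimal) auto
    show "V \<subseteq> span (insert u B)"
    proof
      fix x assume x: "x \<in> V"
      have "x - (u \<bullet> x) *\<^sub>R u \<in> U" using x u Suc.prems(1) uu
        by (simp add: U_def subspace_diff subspace_scale inner_diff_right)
      then have "x - (u \<bullet> x) *\<^sub>R u \<in> span B" using B(3) by simp
      then show "x \<in> span (insert u B)" using span_breakdown_eq by blast
    qed
  qed
  moreover have "u \<notin> B" using BU(2)[of u] uu by auto
  ultimately show ?case using B u BU uu by (intro exI[of _ "insert u B"]) auto
qed

text \<open>These are the conditions that \<open>matrix_sqrt\<close> puts on a root, so one
  predicate serves for covariance matrices and for their roots.\<close>

definition psd_matrix :: "real^'d^'d \<Rightarrow> bool" where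
  "psd_matrix A \<longleftrightarrow> transpose A = A \<and> (\<forall>x. 0 \<le> x \<bullet> (A *v x))"

lemma symmetric_matrix_inner:
  fixes A :: "real^'d^'d"
  assumes "transpose A = A"
  shows "(A *v x) \<bullet> y = x \<bullet> (A *v y)"
  using assms by (metis dot_lmul_matrix transpose_matrix_vector)

lemma psd_matrix_eigenbasis:
  fixes A :: "real^'d^'d"
  assumes "psd_matrix A"
  obtains B where "finite B" "\<And>x y. x \<in> B \<Longrightarrow> y \<in> B \<Longrightarrow> x \<bullet> y = (if x = y then 1 else 0)"
    "span B = UNIV" "\<And>x. x \<in> B \<Longrightarrow> A *v x = (x \<bullet> (A *v x)) *\<^sub>R x"
proof -
  have "transpose A = A" using assms by (simp add: psd_matrix_def)
  have "\<exists>B. finite B \<and> (\<forall>x\<in>B. \<forall>y\<in>B. x \<bullet> y = (if x = y then 1 else 0)) \<and> span B = UNIV \<and>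
      (\<forall>x\<in>B. A *v x = (x \<bullet> (A *v x)) *\<^sub>R x)"
    by (rule self_adjoint_orthonormal_eigenbasis)
      (simp_all add: symmetric_matrix_inner[OF \<open>transpose A = A\<close>])
  then obtain B where "finite B \<and> (\<forall>x\<in>B. \<forall>y\<in>B. x \<bullet> y = (if x = y then 1 else 0)) \<and> span B = UNIV \<and>
      (\<forall>x\<in>B. A *v x = (x \<bullet> (A *v x)) *\<^sub>R x)"
    by (rule exE)
  then show thesis by (intro that[of B]) simp_all
qed

text \<open>In an orthonormal eigenbasis, replace each eigenvalue by its square root and read off
  the matrix of the resulting linear map.\<close>

lemma psd_matrix_sqrt_exists:
  fixes A :: "real^'d^'d"
  assumes A: "psd_matrix A"
  shows "\<exists>B. psd_matrix B \<and> B ** B = A"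
proof -
  obtain E where E: "finite E" "\<And>x y. x \<in> E \<Longrightarrow> y \<in> E \<Longrightarrow> x \<bullet> y = (if x = y then 1 else 0)"
    "span E = UNIV" "\<And>x. x \<in> E \<Longrightarrow> A *v x = (x \<bullet> (A *v x)) *\<^sub>R x"
    using psd_matrix_eigenbasis[OF A] by blast
  \<comment> \<open>On a basis vector, \<open>e \<bullet> (A *v e)\<close> is the eigenvalue, so
    \<open>s e\<close> is its root.\<close>
  define s where "s e = sqrt (e \<bullet> (A *v e))" for e
  have s: "0 \<le> s e" "s e * s e = e \<bullet> (A *v e)" for e
    using A by (auto simp: s_def psd_matrix_def)
  define g where "g x = (\<Sum>e\<in>E. (s e * (e \<bullet> x)) *\<^sub>R e)" for x
  have lin: "linear g"
    by (rule linearI) (auto simp: g_def inner_add_right scaleR_left_distrib sum.distrib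
        scaleR_sum_right algebra_simps)
  define B where "B = matrix g"
  have Bg: "B *v x = g x" for x
    using lin by (simp add: B_def matrix_works linear_matrix_vector_mul_eq)
  have ge: "g e = s e *\<^sub>R e" if "e \<in> E" for e
  proof -
    have "g e = (\<Sum>d\<in>E. if d = e then s e *\<^sub>R e else 0)"
      unfolding g_def by (rule sum.cong) (use that E(2) in auto)
    then show ?thesis using that E(1) by simp
  qed
  have adj: "g x \<bullet> y = x \<bullet> g y" for x y
    by (simp add: g_def inner_sum_left inner_sum_right inner_commute mult.commute mult.left_commute)
  have "transpose B = B"
  proof -
    have "(B *v x) \<bullet> y = (transpose B *v x) \<bullet> y" for x y
      by (metis Bg adj dot_lmul_matrix transpose_matrix_vector)
    then show ?thesis by (metis matrix_eq vector_eq_rdot)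
  qed
  moreover have "0 \<le> x \<bullet> (B *v x)" for x
  proof -
    have "x \<bullet> (B *v x) = (\<Sum>e\<in>E. s e * (e \<bullet> x)\<^sup>2)"
      by (simp add: Bg g_def inner_sum_right inner_commute[of x] power2_eq_square mult.assoc)
    then show ?thesis by (simp add: s sum_nonneg)
  qed
  moreover have "B ** B = A"
  proof -
    have "g (g x) = A *v x" for x
    proof (rule linear_eq_on_span[of "\<lambda>x. g (g x)" "(*v) A" E])
      show "linear (\<lambda>x. g (g x))" using linear_compose[OF lin lin] by (simp add: o_def)
      show "g (g e) = A *v e" if "e \<in> E" for e
        using E(4)[OF that] ge[OF that] s(2)[of e] by (simp add: linear_scale[OF lin])
    qed (use E in auto)
    then show ?thesis by (simp add: matrix_eq Bg flip: matrix_vector_mul_assoc)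
  qed
  ultimately show ?thesis unfolding psd_matrix_def by blast
qed

text \<open>If \<open>e\<close> is an eigenvector of \<open>B\<close> with eigenvalue
  \<open>b\<close>, then applying \<open>C\<close> twice to \<open>e\<close> gives
  \<open>b * b\<close> times \<open>e\<close>, and positivity of \<open>C\<close> forces
  \<open>C *v e = b *\<^sub>R e\<close>. Such vectors span the space.\<close>

lemma psd_matrix_sqrt_unique:
  fixes B C :: "real^'d^'d"
  assumes B: "psd_matrix B" and C: "psd_matrix C" and eq: "B ** B = C ** C"
  shows "B = C"
proof -
  obtain E where E: "span E = UNIV" "\<And>x. x \<in> E \<Longrightarrow> B *v x = (x \<bullet> (B *v x)) *\<^sub>R x"
    using psd_matrix_eigenbasis[OF B] by metis
  have "B *v e = C *v e" if "e \<in> E" for e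
  proof -
    define b where "b = e \<bullet> (B *v e)"
    have Be: "B *v e = b *\<^sub>R e" using E(2)[OF that] b_def by simp
    have b: "b \<ge> 0" using B by (simp add: b_def psd_matrix_def)
    have CC: "C *v (C *v e) = (b * b) *\<^sub>R e"
      using eq Be by (metis matrix_vector_mul_assoc matrix_vector_mult_scaleR scaleR_scaleR)
    have sym: "(C *v x) \<bullet> y = x \<bullet> (C *v y)" for x y
      using symmetric_matrix_inner C psd_matrix_def by metis
    show ?thesis
    proof (cases "b = 0")
      case True
      \<comment> \<open>By symmetry of \<open>C\<close> the squared length of \<open>C *v e\<close>
        is \<open>e \<bullet> (C *v (C *v e))\<close>, which is 0 here.\<close>
      then have "(C *v e) \<bullet> (C *v e) = 0" using sym[of e "C *v e"] CC by simp
      then show ?thesis using Be True by simp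
    next
      case False
      \<comment> \<open>\<open>(C + b) (C - b) e = 0\<close>, and \<open>C + b\<close> is injective for \<open>b > 0\<close>.\<close>
      define y where "y = C *v e - b *\<^sub>R e"
      have "C *v y = - b *\<^sub>R y"
        by (simp add: y_def matrix_vector_mult_diff_distrib CC matrix_vector_mult_scaleR algebra_simps)
      then have "0 \<le> - b * (y \<bullet> y)" using C unfolding psd_matrix_def
        by (metis inner_scaleR_right)
      then have "y \<bullet> y \<le> 0" using b False by (simp add: mult_le_0_iff zero_le_mult_iff)
      then have "y = 0" by (metis inner_ge_zero inner_eq_zero_iff order_antisym)
      then show ?thesis using Be by (simp add: y_def)
    qed
  qed
  then have "B *v x = C *v x" for x
    using linear_eq_on_span[of "(*v) B" "(*v) C" E x] E(1) by auto
  then show ?thesis by (simp add: matrix_eq)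
qed

text \<open>Uniqueness discharges the definite description, so a root is identified by exhibiting
  it.\<close>

lemma matrix_sqrt_eqI:
  assumes "psd_matrix B" "B ** B = A"
  shows "matrix_sqrt A = B"
  unfolding matrix_sqrt_def using assms
  by (intro the_equality) (auto simp: psd_matrix_def intro!: psd_matrix_sqrt_unique)

lemma matrix_sqrt_psd:
  assumes "psd_matrix A"
  shows "psd_matrix (matrix_sqrt A)" "matrix_sqrt A ** matrix_sqrt A = A"
  using psd_matrix_sqrt_exists[OF assms] matrix_sqrt_eqI by metis+

lemma matrix_sqrt_mat_1: "matrix_sqrt (mat 1) = mat 1"
  by (rule matrix_sqrt_eqI) (auto simp: psd_matrix_def)

lemma matrix_inv_eqI:
  fixes A B :: "real^'d^'d"
  assumes "A ** B = mat 1" "B ** A = mat 1"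
  shows "matrix_inv A = B"
proof -
  have "A ** matrix_inv A = mat 1 \<and> matrix_inv A ** A = mat 1"
    unfolding matrix_inv_def by (rule someI[of _ B]) (use assms in auto)
  then show ?thesis using assms by (metis matrix_mul_assoc matrix_mul_lid matrix_mul_rid)
qed

text \<open>If \<open>C\<close> inverts \<open>A\<close>, then the root composed with
  \<open>C\<close> on either side gives a one-sided inverse of the root; the two agree and equal
  \<open>W\<close>. Transposing the inverse identities shows that \<open>transpose W\<close> also
  inverts the symmetric root, whence \<open>W\<close> is symmetric.\<close>

lemma inverse_sqrt_whitens:
  fixes A :: "real^'d^'d"
  assumes A: "psd_matrix A" and inv: "invertible A"
  defines "W \<equiv> matrix_inv (matrix_sqrt A)"
  shows "transpose W = W" "W ** A ** W = mat 1"
proof -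
  let ?B = "matrix_sqrt A"
  have B: "transpose ?B = ?B" "?B ** ?B = A"
    using matrix_sqrt_psd[OF A] by (auto simp: psd_matrix_def)
  obtain C where C: "A ** C = mat 1" "C ** A = mat 1" using inv by (auto simp: invertible_def)
  have 1: "?B ** (?B ** C) = mat 1" "(C ** ?B) ** ?B = mat 1"
    using B C by (metis matrix_mul_assoc)+
  then have "C ** ?B = ?B ** C" by (metis matrix_mul_assoc matrix_mul_lid matrix_mul_rid)
  then have W: "W = ?B ** C" "?B ** W = mat 1" "W ** ?B = mat 1"
    using 1 matrix_inv_eqI[of ?B "?B ** C"] by (auto simp: W_def)
  show "W ** A ** W = mat 1"
    using W B by (metis matrix_mul_assoc matrix_mul_lid)
  have "transpose W ** ?B = mat 1" "?B ** transpose W = mat 1"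
    using W(2,3) B(1) by (metis matrix_transpose_mul transpose_mat)+
  then show "transpose W = W" using matrix_inv_eqI[of ?B "transpose W"] by (simp add: W_def)
qed

section \<open>Covariances and affine combinations of Gaussian processes\<close>

text \<open>Square integrability of a random variable: on a probability space these variables have
  finite means, and their covariances are bilinear.\<close>

definition square_integrable :: "'a measure \<Rightarrow> ('a \<Rightarrow> real) \<Rightarrow> bool" where
  "square_integrable M X \<longleftrightarrow> X \<in> borel_measurable M \<and> integrable M (\<lambda>\<omega>. (X \<omega>)\<^sup>2)"

lemma square_integrable_mult:
  assumes "square_integrable M X" "square_integrable M Y"
  shows "integrable M (\<lambda>\<omega>. X \<omega> * Y \<omega>)"
proof (rule Bochner_Integration.integrable_bound)
  show "integrable M (\<lambda>\<omega>. (X \<omega>)\<^sup>2 + (Y \<omega>)\<^sup>2)"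
    using assms by (auto simp: square_integrable_def)
  have "\<bar>x * y\<bar> \<le> x\<^sup>2 + y\<^sup>2" for x y :: real
    using sum_squares_bound[of x y] sum_squares_bound[of "-x" y] zero_le_power2[of x] zero_le_power2[of y]
    by (auto simp: abs_le_iff)
  then show "AE \<omega> in M. norm (X \<omega> * Y \<omega>) \<le> norm ((X \<omega>)\<^sup>2 + (Y \<omega>)\<^sup>2)"
    by simp
qed (use assms in \<open>auto simp: square_integrable_def\<close>)

lemma square_integrable_integrable:
  assumes "prob_space M" "square_integrable M X"
  shows "integrable M X"
  using assms finite_measure.square_integrable_imp_integrable
  by (auto simp: square_integrable_def prob_space_def)

lemma square_integrable_diff_const:
  assumes "prob_space M" "square_integrable M X"
  shows "square_integrable M (\<lambda>\<omega>. X \<omega> - c)"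
proof -
  interpret prob_space M by fact
  have "integrable M X" by (rule square_integrable_integrable) fact+
  then show ?thesis using assms by (auto simp: square_integrable_def power2_diff)
qed

lemma cov_commute: "cov M X Y = cov M Y X"
  by (simp add: cov_def mult.commute)

text \<open>Centring removes the constant, and square integrability makes every product integrable,
  so the expectation may be split over the sum.\<close>

lemma cov_affine_sum_left:
  assumes M: "prob_space M" and X: "\<And>k. k \<in> F \<Longrightarrow> square_integrable M (X k)"
    and Y: "square_integrable M Y"
  shows "cov M (\<lambda>\<omega>. c + (\<Sum>k\<in>F. a k * X k \<omega>)) Y = (\<Sum>k\<in>F. a k * cov M (X k) Y)"
proof -
  interpret prob_space M by fact
  have int: "integrable M (X k)" if "k \<in> F" for k
    using square_integrable_integrable[OF M X[OF that]] .
  have E: "expectation (\<lambda>\<omega>. c + (\<Sum>k\<in>F. a k * X k \<omega>)) = c + (\<Sum>k\<in>F. a k * expectation (X k))"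
    using int by (simp add: prob_space)
  have "cov M (\<lambda>\<omega>. c + (\<Sum>k\<in>F. a k * X k \<omega>)) Y =
      expectation (\<lambda>\<omega>. \<Sum>k\<in>F. a k * ((X k \<omega> - expectation (X k)) * (Y \<omega> - expectation Y)))"
    unfolding cov_def E
    by (simp add: sum_subtractf sum_distrib_right left_diff_distrib mult.assoc right_diff_distrib)
  also have "\<dots> = (\<Sum>k\<in>F. a k * cov M (X k) Y)"
    unfolding cov_def using X Y M
    by (simp add: square_integrable_mult square_integrable_diff_const)
  finally show ?thesis .
qed

text \<open>A point mass is almost surely constant; otherwise the second moment about \<mu> comes
  from the normal density, and shifting by \<mu> preserves square integrability.\<close>

lemma gaussian_rv_square_integrable:
  assumes "prob_space M" "gaussian_rv M X"
  shows "square_integrable M X"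
proof -
  interpret prob_space M by fact
  have X: "X \<in> borel_measurable M" using assms(2) by (simp add: gaussian_rv_def)
  obtain \<mu> where "(AE \<omega> in M. X \<omega> = \<mu>) \<or> (\<exists>\<sigma>>0. distributed M lborel X (normal_density \<mu> \<sigma>))"
    using assms(2) by (auto simp: gaussian_rv_def)
  then show ?thesis
  proof
    assume "AE \<omega> in M. X \<omega> = \<mu>"
    then have "integrable M (\<lambda>\<omega>. (X \<omega>)\<^sup>2) \<longleftrightarrow> integrable M (\<lambda>\<omega>. \<mu>\<^sup>2)"
      using X by (intro integrable_cong_AE) auto
    then show ?thesis using X by (simp add: square_integrable_def)
  next
    assume "\<exists>\<sigma>>0. distributed M lborel X (normal_density \<mu> \<sigma>)"
    then obtain \<sigma> where \<sigma>: "\<sigma> > 0" and D: "distributed M lborel X (normal_density \<mu> \<sigma>)" by blast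
    have "integrable M (\<lambda>\<omega>. (X \<omega> - \<mu>)\<^sup>2)"
      using distributed_integrable[OF D, of "\<lambda>x. (x - \<mu>)\<^sup>2"] integrable_normal_moment[OF \<sigma>, of \<mu> 2]
      by simp
    then have "square_integrable M (\<lambda>\<omega>. X \<omega> - \<mu>)" using X by (simp add: square_integrable_def)
    from square_integrable_diff_const[OF assms(1) this, of "-\<mu>"] show ?thesis by simp
  qed
qed

lemma gaussian_rv_add_const:
  assumes "prob_space M" "gaussian_rv M X"
  shows "gaussian_rv M (\<lambda>\<omega>. c + X \<omega>)"
proof -
  interpret prob_space M by fact
  obtain \<mu> where "(AE \<omega> in M. X \<omega> = \<mu>) \<or> (\<exists>\<sigma>>0. distributed M lborel X (normal_density \<mu> \<sigma>))"
    using assms(2) by (auto simp: gaussian_rv_def)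
  then have "(AE \<omega> in M. c + X \<omega> = c + \<mu>) \<or>
      (\<exists>\<sigma>>0. distributed M lborel (\<lambda>\<omega>. c + X \<omega>) (normal_density (c + \<mu>) \<sigma>))"
    using normal_density_affine[of X \<mu> _ 1 c] by fastforce
  then show ?thesis using assms(2) by (auto simp: gaussian_rv_def)
qed

text \<open>All variables that inherit Gaussianity from the process \<open>X\<close>. The constant
  \<open>c\<close> is there because signals get centred and shifted.\<close>

definition affine_combs :: "'t set \<Rightarrow> ('t \<Rightarrow> 'a \<Rightarrow> real) \<Rightarrow> ('a \<Rightarrow> real) set" where
  "affine_combs I X =
     {Y. \<exists>F a c. finite F \<and> F \<subseteq> I \<and> Y = (\<lambda>\<omega>. c + (\<Sum>t\<in>F. a t * X t \<omega>))}"

lemma affine_combs_const: "(\<lambda>\<omega>. c) \<in> affine_combs I X"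
  unfolding affine_combs_def by (auto intro!: exI[of _ "{}"])

lemma affine_combs_base: "t \<in> I \<Longrightarrow> X t \<in> affine_combs I X"
  unfolding affine_combs_def by (auto intro!: exI[of _ "{t}"] exI[of _ "\<lambda>_. 1"] exI[of _ 0])

lemma affine_combs_add:
  assumes "Y \<in> affine_combs I X" "Z \<in> affine_combs I X"
  shows "(\<lambda>\<omega>. Y \<omega> + Z \<omega>) \<in> affine_combs I X"
proof -
  obtain F a c where Y: "finite F" "F \<subseteq> I" "Y = (\<lambda>\<omega>. c + (\<Sum>t\<in>F. a t * X t \<omega>))"
    using assms(1) by (auto simp: affine_combs_def)
  obtain G b d where Z: "finite G" "G \<subseteq> I" "Z = (\<lambda>\<omega>. d + (\<Sum>t\<in>G. b t * X t \<omega>))"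
    using assms(2) by (auto simp: affine_combs_def)
  \<comment> \<open>Both coefficient families are extended by zero to the union of the index sets,
    so that shared indices add up.\<close>
  define e where "e t = (if t \<in> F then a t else 0) + (if t \<in> G then b t else 0)" for t
  have "(\<Sum>t\<in>F. a t * X t \<omega>) = (\<Sum>t\<in>F \<union> G. (if t \<in> F then a t else 0) * X t \<omega>)"
    "(\<Sum>t\<in>G. b t * X t \<omega>) = (\<Sum>t\<in>F \<union> G. (if t \<in> G then b t else 0) * X t \<omega>)" for \<omega>
    using Y(1) Z(1) by (auto intro!: sum.mono_neutral_cong_left)
  then have "Y \<omega> + Z \<omega> = (c + d) + (\<Sum>t\<in>F \<union> G. e t * X t \<omega>)" for \<omega>
    unfolding Y(3) Z(3) e_def by (simp add: distrib_right sum.distrib)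
  then show ?thesis using Y Z unfolding affine_combs_def
    by (intro CollectI exI[of _ "F \<union> G"] exI[of _ e] exI[of _ "c + d"]) auto
qed

lemma affine_combs_mult:
  assumes "Y \<in> affine_combs I X"
  shows "(\<lambda>\<omega>. r * Y \<omega>) \<in> affine_combs I X"
proof -
  obtain F a c where Y: "finite F" "F \<subseteq> I" "Y = (\<lambda>\<omega>. c + (\<Sum>t\<in>F. a t * X t \<omega>))"
    using assms by (auto simp: affine_combs_def)
  then have "(\<lambda>\<omega>. r * Y \<omega>) = (\<lambda>\<omega>. r * c + (\<Sum>t\<in>F. (r * a t) * X t \<omega>))"
    by (simp add: distrib_left sum_distrib_left mult.assoc)
  then show ?thesis using Y unfolding affine_combs_def mem_Collect_eq
    by (intro exI[of _ F] exI[of _ "\<lambda>t. r * a t"] exI[of _ "r * c"]) simp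
qed

lemma affine_combs_sum:
  assumes "\<And>s. s \<in> F \<Longrightarrow> Y s \<in> affine_combs I X"
  shows "(\<lambda>\<omega>. \<Sum>s\<in>F. a s * Y s \<omega>) \<in> affine_combs I X"
  using assms
proof (induction F rule: infinite_finite_induct)
  case (insert s F)
  then show ?case
    using affine_combs_add[OF affine_combs_mult[of "Y s" I X "a s"]] by simp
qed (simp_all add: affine_combs_const)

lemma gaussian_process_affine_comb:
  assumes "gaussian_process M I X" "Y \<in> affine_combs I X"
  shows "gaussian_rv M Y"
  using assms gaussian_rv_add_const by (fastforce simp: gaussian_process_def affine_combs_def)

text \<open>A finite linear combination of affine combinations of \<open>X\<close> is again one,
  hence Gaussian. This gives joint normality of the state with the new signals and with the
  noise.\<close>

lemma gaussian_process_affine_combs: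
  assumes "gaussian_process M I X" "\<And>s. s \<in> J \<Longrightarrow> Y s \<in> affine_combs I X"
  shows "gaussian_process M J Y"
  unfolding gaussian_process_def
proof (intro conjI allI impI)
  show "prob_space M" using assms(1) by (simp add: gaussian_process_def)
  show "gaussian_rv M (\<lambda>\<omega>. \<Sum>t\<in>F. a t * Y t \<omega>)" if "finite F \<and> F \<subseteq> J" for F a
    using that by (intro gaussian_process_affine_comb[OF assms(1)] affine_combs_sum assms(2)) auto
qed

section \<open>Measurability\<close>

text \<open>Lebesgue measurable sets are Borel sets up to null sets, so besides Borel measurability
  the preimage of a null set must be null: it is a cylinder over a null set, of product measure
  zero.\<close>

lemma fst_lebesgue_measurable:
  "(fst :: 'a::euclidean_space \<times> 'b::euclidean_space \<Rightarrow> 'a) \<in> lebesgue \<rightarrow>\<^sub>M lebesgue"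
proof (rule completion.measurable_completion2)
  show m: "(fst :: 'a \<times> 'b \<Rightarrow> 'a) \<in> lebesgue \<rightarrow>\<^sub>M lborel"
    by (auto intro!: measurable_completion simp: borel_prod[symmetric])
  show "null_sets lborel \<subseteq> null_sets (distr lebesgue lborel (fst :: 'a \<times> 'b \<Rightarrow> 'a))"
  proof
    fix A :: "'a set" assume A: "A \<in> null_sets lborel"
    then have "emeasure (lborel \<Otimes>\<^sub>M lborel) (A \<times> (UNIV::'b set)) = 0"
      by (subst lborel.emeasure_pair_measure_Times) (auto simp: null_sets_def)
    then have "fst -` A \<in> null_sets (lebesgue :: ('a \<times> 'b) measure)"
      using A by (auto intro!: null_sets_completionI simp: null_sets_def lborel_prod borel_Times
          vimage_fst)
    then show "A \<in> null_sets (distr lebesgue lborel (fst :: 'a \<times> 'b \<Rightarrow> 'a))"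
      using A null_sets_distr_iff[OF m, of A] by auto
  qed
qed

lemma snd_lebesgue_measurable:
  "(snd :: 'a::euclidean_space \<times> 'b::euclidean_space \<Rightarrow> 'b) \<in> lebesgue \<rightarrow>\<^sub>M lebesgue"
proof (rule completion.measurable_completion2)
  show m: "(snd :: 'a \<times> 'b \<Rightarrow> 'b) \<in> lebesgue \<rightarrow>\<^sub>M lborel"
    by (auto intro!: measurable_completion simp: borel_prod[symmetric])
  show "null_sets lborel \<subseteq> null_sets (distr lebesgue lborel (snd :: 'a \<times> 'b \<Rightarrow> 'b))"
  proof
    fix A :: "'b set" assume A: "A \<in> null_sets lborel"
    then have "emeasure (lborel \<Otimes>\<^sub>M lborel) ((UNIV::'a set) \<times> A) = 0"
      by (subst lborel.emeasure_pair_measure_Times) (auto simp: null_sets_def)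
    then have "snd -` A \<in> null_sets (lebesgue :: ('a \<times> 'b) measure)"
      using A by (auto intro!: null_sets_completionI simp: null_sets_def lborel_prod borel_Times
          vimage_snd)
    then show "A \<in> null_sets (distr lebesgue lborel (snd :: 'a \<times> 'b \<Rightarrow> 'b))"
      using A null_sets_distr_iff[OF m, of A] by auto
  qed
qed

text \<open>Lifts a function of one agent to pairs of agents, as the measurability of a correlation
  kernel requires.\<close>

lemma lebesgue_on_Times_fst:
  fixes A :: "'a::euclidean_space set" and B :: "'b::euclidean_space set"
  assumes "f \<in> lebesgue_on A \<rightarrow>\<^sub>M N"
  shows "(\<lambda>x. f (fst x)) \<in> lebesgue_on (A \<times> B) \<rightarrow>\<^sub>M N"
proof (rule measurable_compose[OF _ assms])
  show "fst \<in> lebesgue_on (A \<times> B) \<rightarrow>\<^sub>M lebesgue_on A"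
    by (rule measurable_restrict_space3[OF fst_lebesgue_measurable]) auto
qed

lemma lebesgue_on_Times_snd:
  fixes A :: "'a::euclidean_space set" and B :: "'b::euclidean_space set"
  assumes "f \<in> lebesgue_on B \<rightarrow>\<^sub>M N"
  shows "(\<lambda>x. f (snd x)) \<in> lebesgue_on (A \<times> B) \<rightarrow>\<^sub>M N"
proof (rule measurable_compose[OF _ assms])
  show "snd \<in> lebesgue_on (A \<times> B) \<rightarrow>\<^sub>M lebesgue_on B"
    by (rule measurable_restrict_space3[OF snd_lebesgue_measurable]) auto
qed

text \<open>Normalise \<phi> where it is nonzero, use a fixed unit vector elsewhere, and flip the
  sign wherever the inner product with \<open>p\<close> is negative. Flipping leaves
  \<open>(v x \<bullet> \<phi> x) *\<^sub>R v x\<close> unchanged, and all case distinctions are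
  measurable.\<close>

lemma unit_direction_measurable:
  fixes \<phi> p :: "'c \<Rightarrow> 'b::euclidean_space"
  assumes [measurable]: "\<phi> \<in> borel_measurable N" "p \<in> borel_measurable N"
  obtains v where "v \<in> borel_measurable N" "\<And>x. norm (v x) = 1" "\<And>x. \<phi> x = (v x \<bullet> \<phi> x) *\<^sub>R v x"
    "\<And>x. 0 \<le> v x \<bullet> p x"
proof -
  obtain e :: 'b where e: "norm e = 1" using vector_choose_size[of 1] by auto
  define u where "u x = (if \<phi> x = 0 then e else inverse (norm (\<phi> x)) *\<^sub>R \<phi> x)" for x
  define v where "v x = (if 0 \<le> u x \<bullet> p x then u x else - u x)" for x
  have [measurable]: "u \<in> borel_measurable N" unfolding u_def by measurable
  have u: "norm (u x) = 1" "\<phi> x = (u x \<bullet> \<phi> x) *\<^sub>R u x" for x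
    using e by (auto simp: u_def dot_square_norm power2_eq_square divide_simps)
  show thesis
  proof (rule that[of v])
    show "v \<in> borel_measurable N" unfolding v_def by measurable
  qed (use u in \<open>auto simp: v_def\<close>)
qed

lemma borel_measurable_vec_iff:
  fixes f :: "'a \<Rightarrow> real^'d"
  shows "f \<in> borel_measurable N \<longleftrightarrow> (\<forall>k. (\<lambda>x. f x $ k) \<in> borel_measurable N)"
  by (subst borel_measurable_euclidean_space) (auto simp: Basis_vec_def inner_axis)

section \<open>Whitened signals\<close>

lemma cov_affine_pair_left:
  assumes "prob_space M" "square_integrable M X" "square_integrable M Z" "square_integrable M Y"
  shows "cov M (\<lambda>\<omega>. c + (a * X \<omega> + b * Z \<omega>)) Y = a * cov M X Y + b * cov M Z Y"
  using cov_affine_sum_left[of M UNIV "\<lambda>k. if k then X else Z" Y c "\<lambda>k. if k then a else b"] assms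
  by (simp add: UNIV_bool add.commute)

text \<open>Brings a centred linear functional into the shape expected by
  \<open>cov_affine_sum_left\<close> and \<open>affine_combs\<close>.\<close>

lemma inner_diff_eq_affine_sum:
  fixes a x m :: "real^'d"
  shows "a \<bullet> (x - m) = - (a \<bullet> m) + (\<Sum>k\<in>UNIV. a $ k * x $ k)"
  by (simp add: inner_vec_def right_diff_distrib sum_subtractf)

lemma info_structureD:
  fixes S :: "real \<Rightarrow> 'a \<Rightarrow> real^'d"
  assumes "info_structure \<mu> \<sigma> M \<theta> S"
  shows "prob_space M" "square_integrable M \<theta>"
    and "\<And>i k. i \<in> agents \<Longrightarrow> square_integrable M (\<lambda>\<omega>. S i \<omega> $ k)"
proof -
  let ?I = "insert None (Some ` (agents \<times> (UNIV :: 'd set)))"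
  let ?X = "case_option \<theta> (\<lambda>(i, k) \<omega>. S i \<omega> $ k)"
  have G: "gaussian_process M ?I ?X"
    using assms by (simp add: info_structure_def gaussian_with_state_def)
  then show M: "prob_space M" by (simp add: gaussian_process_def)
  have "square_integrable M (?X t)" if "t \<in> ?I" for t
    by (rule gaussian_rv_square_integrable[OF M gaussian_process_affine_comb[OF G affine_combs_base[OF that]]])
  from this[of None] this[of "Some (i, k)" for i k]
  show "square_integrable M \<theta>" "\<And>i k. i \<in> agents \<Longrightarrow> square_integrable M (\<lambda>\<omega>. S i \<omega> $ k)"
    by auto
qed

context
  fixes \<mu> \<sigma> :: real and M :: "'a measure" and \<theta> :: "'a \<Rightarrow> real" and S :: "real \<Rightarrow> 'a \<Rightarrow> real^'d"
  assumes info: "info_structure \<mu> \<sigma> M \<theta> S"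
begin

interpretation prob_space M by (rule info_structureD[OF info])

lemma expectation_centered_signal:
  assumes "i \<in> agents"
  shows "expectation (\<lambda>\<omega>. a \<bullet> (S i \<omega> - sig_mean M S i)) = 0"
  unfolding inner_diff_eq_affine_sum
  using square_integrable_integrable[OF prob_space_axioms info_structureD(3)[OF info assms]]
  by (simp add: prob_space sig_mean_def inner_vec_def)

lemma cov_centered_signal_left:
  assumes "i \<in> agents" "square_integrable M Y"
  shows "cov M (\<lambda>\<omega>. a \<bullet> (S i \<omega> - sig_mean M S i)) Y = (\<Sum>k\<in>UNIV. a $ k * cov M (\<lambda>\<omega>. S i \<omega> $ k) Y)"
  unfolding inner_diff_eq_affine_sum
  using assms info_structureD[OF info] by (intro cov_affine_sum_left) auto

lemma cov_centered_signal_right: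
  assumes "i \<in> agents" "square_integrable M Y"
  shows "cov M Y (\<lambda>\<omega>. a \<bullet> (S i \<omega> - sig_mean M S i)) = (\<Sum>k\<in>UNIV. a $ k * cov M Y (\<lambda>\<omega>. S i \<omega> $ k))"
  using cov_centered_signal_left[OF assms] by (simp add: cov_commute)

lemma cov_centered_signal_state:
  assumes "i \<in> agents"
  shows "cov M (\<lambda>\<omega>. a \<bullet> (S i \<omega> - sig_mean M S i)) \<theta> = a \<bullet> sig_state_cov M \<theta> S i"
  using cov_centered_signal_left[OF assms info_structureD(2)[OF info]]
  by (simp add: sig_state_cov_def inner_vec_def)

lemma centered_signal_affine_comb:
  assumes "i \<in> agents"
  shows "(\<lambda>\<omega>. a \<bullet> (S i \<omega> - sig_mean M S i)) \<in>
    affine_combs (insert None (Some ` (agents \<times> UNIV))) (case_option \<theta> (\<lambda>(i, k) \<omega>. S i \<omega> $ k))"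
  unfolding inner_diff_eq_affine_sum
proof (intro affine_combs_add affine_combs_const affine_combs_sum)
  show "(\<lambda>\<omega>. S i \<omega> $ k) \<in>
    affine_combs (insert None (Some ` (agents \<times> UNIV))) (case_option \<theta> (\<lambda>(i, k) \<omega>. S i \<omega> $ k))" for k
    using assms affine_combs_base[of "Some (i, k)" "insert None (Some ` (agents \<times> UNIV))"
        "case_option \<theta> (\<lambda>(i, k) \<omega>. S i \<omega> $ k)"] by auto
qed

lemma centered_signal_square_integrable:
  assumes "i \<in> agents"
  shows "square_integrable M (\<lambda>\<omega>. a \<bullet> (S i \<omega> - sig_mean M S i))"
  using info assms
  by (intro gaussian_rv_square_integrable prob_space_axioms
      gaussian_process_affine_comb[OF _ centered_signal_affine_comb])
    (simp_all add: info_structure_def gaussian_with_state_def)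

lemma cov_centered_signals:
  assumes "i \<in> agents" "j \<in> agents"
  shows "cov M (\<lambda>\<omega>. a \<bullet> (S i \<omega> - sig_mean M S i)) (\<lambda>\<omega>. b \<bullet> (S j \<omega> - sig_mean M S j)) =
    a \<bullet> (sig_cov M S i j *v b)"
proof -
  have "cov M (\<lambda>\<omega>. a \<bullet> (S i \<omega> - sig_mean M S i)) (\<lambda>\<omega>. b \<bullet> (S j \<omega> - sig_mean M S j)) =
      (\<Sum>k\<in>UNIV. a $ k * (\<Sum>l\<in>UNIV. b $ l * sig_cov M S i j $ k $ l))"
    unfolding cov_centered_signal_left[OF assms(1) centered_signal_square_integrable[OF assms(2)]]
      cov_centered_signal_right[OF assms(2) info_structureD(3)[OF info assms(1)]]
    by (simp add: sig_cov_def)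
  then show ?thesis by (simp add: inner_vec_def matrix_vector_mult_def mult.commute)
qed

text \<open>The quadratic form at \<open>x\<close> is the variance of
  \<open>x \<bullet> (S i - m i)\<close>, where \<open>m i\<close> is the mean signal.\<close>

lemma psd_sig_cov:
  assumes "i \<in> agents"
  shows "psd_matrix (sig_cov M S i i)"
  unfolding psd_matrix_def
proof (intro conjI allI)
  show "transpose (sig_cov M S i i) = sig_cov M S i i"
    by (simp add: vec_eq_iff transpose_def sig_cov_def cov_commute)
  show "0 \<le> x \<bullet> (sig_cov M S i i *v x)" for x
    unfolding cov_centered_signals[OF assms assms, symmetric] by (simp add: cov_def)
qed

lemma whiten_symmetric: "i \<in> agents \<Longrightarrow> transpose (whiten M S i) = whiten M S i"
  and corr_self: "i \<in> agents \<Longrightarrow> corr M S i i = mat 1"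
  unfolding corr_def whiten_def
  using inverse_sqrt_whitens[OF psd_sig_cov] info by (auto simp: info_structure_def)

lemma inner_whiten: "i \<in> agents \<Longrightarrow> u \<bullet> (whiten M S i *v x) = (whiten M S i *v u) \<bullet> x"
  using symmetric_matrix_inner[OF whiten_symmetric] by simp

text \<open>Symmetry of the whitening matrices moves them from the signals onto the weights
  \<open>u\<close> and \<open>v\<close>; they then surround \<open>sig_cov\<close> exactly as in
  \<open>corr\<close>.\<close>

lemma cov_whitened_signals:
  assumes "i \<in> agents" "j \<in> agents"
  shows "cov M (\<lambda>\<omega>. u \<bullet> (whiten M S i *v (S i \<omega> - sig_mean M S i)))
      (\<lambda>\<omega>. v \<bullet> (whiten M S j *v (S j \<omega> - sig_mean M S j))) = u \<bullet> (corr M S i j *v v)"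
  unfolding inner_whiten[OF assms(1)] inner_whiten[OF assms(2)] cov_centered_signals[OF assms]
  by (simp add: inner_whiten[OF assms(1), symmetric] corr_def matrix_vector_mul_assoc matrix_mul_assoc)

lemma cov_whitened_signal_state:
  assumes "i \<in> agents" "\<sigma> \<noteq> 0"
  shows "cov M (\<lambda>\<omega>. u \<bullet> (whiten M S i *v (S i \<omega> - sig_mean M S i))) \<theta> =
    \<sigma> * (u \<bullet> state_corr \<sigma> M \<theta> S i)"
  unfolding inner_whiten[OF assms(1)] cov_centered_signal_state[OF assms(1)]
  using assms(2) by (simp add: inner_whiten[OF assms(1), symmetric] state_corr_def)

end

lemma matrix_1_vector_mult: "(A :: real^1^1) *v x = vec (A $ 1 $ 1 * x $ 1)"
  by (simp add: vec_eq_iff matrix_vector_mult_def)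

section \<open>The canonical information structure\<close>

theorem mainTheorem7:
  fixes \<mu>\<^sub>\<theta> \<sigma>\<^sub>\<theta> :: real
    and w :: "real \<Rightarrow> real \<Rightarrow> real" and b c :: "real \<Rightarrow> real"
    and M :: "'a measure" and \<theta> :: "'a \<Rightarrow> real" and S :: "real \<Rightarrow> 'a \<Rightarrow> real^'d"
    and \<phi>\<^sub>0 :: "real \<Rightarrow> real" and \<phi> :: "real \<Rightarrow> real^'d"
  assumes "\<sigma>\<^sub>\<theta> > 0"
    and "payoff_structure w b c"
    and "info_structure \<mu>\<^sub>\<theta> \<sigma>\<^sub>\<theta> M \<theta> S"
    and "affine_equilibrium \<mu>\<^sub>\<theta> \<sigma>\<^sub>\<theta> w b c (corr M S) (state_corr \<sigma>\<^sub>\<theta> M \<theta> S) \<phi>\<^sub>0 \<phi>"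
  shows "\<exists>(M' :: 'a measure) (\<theta>' :: 'a \<Rightarrow> real) (S' :: real \<Rightarrow> 'a \<Rightarrow> real^1)
           (\<phi>\<^sub>0' :: real \<Rightarrow> real) (\<phi>' :: real \<Rightarrow> real^1).
           canonical_info_structure \<mu>\<^sub>\<theta> \<sigma>\<^sub>\<theta> M' \<theta>' S' \<and>
           affine_equilibrium \<mu>\<^sub>\<theta> \<sigma>\<^sub>\<theta> w b c (corr M' S') (state_corr \<sigma>\<^sub>\<theta> M' \<theta>' S') \<phi>\<^sub>0' \<phi>' \<and>
           outcome_law M \<theta> (outcome M S \<phi>\<^sub>0 \<phi>) = outcome_law M' \<theta>' (outcome M' S' \<phi>\<^sub>0' \<phi>')"
proof -
  note info = assms(3)
  interpret prob_space M by (rule info_structureD[OF info])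
  note M = prob_space_axioms
  note \<theta>_sq = info_structureD(2)[OF info]
  have \<theta>_int: "integrable M \<theta>" by (rule square_integrable_integrable[OF M \<theta>_sq])
  have \<theta>_dist: "distributed M lborel \<theta> (normal_density \<mu>\<^sub>\<theta> \<sigma>\<^sub>\<theta>)"
    using info by (simp add: info_structure_def)
  have E\<theta>: "expectation \<theta> = \<mu>\<^sub>\<theta>" "cov M \<theta> \<theta> = \<sigma>\<^sub>\<theta>\<^sup>2"
    using normal_distributed_expectation[OF assms(1) \<theta>_dist] normal_distributed_variance[OF assms(1) \<theta>_dist]
    by (simp_all add: cov_def power2_eq_square)
  let ?P = "corr M S" and ?p = "state_corr \<sigma>\<^sub>\<theta> M \<theta> S"
  let ?I = "insert None (Some ` (agents \<times> (UNIV :: 'd set)))"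
  let ?X = "case_option \<theta> (\<lambda>(i, k) \<omega>. S i \<omega> $ k)"
  let ?L = "lebesgue_on agents"
  have G: "gaussian_process M ?I ?X"
    using info by (simp add: info_structure_def gaussian_with_state_def)

  \<comment> \<open>Measurable directions of the equilibrium weights\<close>
  have \<phi>_meas[measurable]: "\<phi> \<in> borel_measurable ?L" and p_meas[measurable]: "?p \<in> borel_measurable ?L"
    unfolding borel_measurable_vec_iff using assms(3,4)
    by (auto simp: affine_equilibrium_def square_integrable_on_def info_structure_def)
  obtain v where v_meas[measurable]: "v \<in> borel_measurable ?L" and v_norm: "\<And>i. norm (v i) = 1"
    and \<phi>_eq: "\<And>i. \<phi> i = (v i \<bullet> \<phi> i) *\<^sub>R v i" and v_p: "\<And>i. 0 \<le> v i \<bullet> ?p i"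
    using unit_direction_measurable[OF \<phi>_meas p_meas] by blast

  \<comment> \<open>The scalar signal and its second moments\<close>
  define q where "q i \<omega> = v i \<bullet> (whiten M S i *v (S i \<omega> - sig_mean M S i))" for i \<omega>
  \<comment> \<open>The covariance of \<open>q i\<close> with \<theta> is
    \<open>\<sigma>\<^sub>\<theta> * (v i \<bullet> ?p i)\<close>; dividing by the variance of
    \<theta> gives \<open>h i\<close>. Thus \<open>h i\<close> is the regression coefficient on the
    state and \<open>\<epsilon> i\<close> the residual, uncorrelated with \<theta>.\<close>
  define h where "h i = (v i \<bullet> ?p i) / \<sigma>\<^sub>\<theta>" for i
  define S' :: "real \<Rightarrow> 'a \<Rightarrow> real^1" where "S' i \<omega> = vec (q i \<omega> + h i * \<mu>\<^sub>\<theta>)" for i \<omega>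
  define \<epsilon> where "\<epsilon> i \<omega> = q i \<omega> - h i * (\<theta> \<omega> - \<mu>\<^sub>\<theta>)" for i \<omega>
  define \<phi>' :: "real \<Rightarrow> real^1" where "\<phi>' i = vec (v i \<bullet> \<phi> i)" for i
  have q_eq: "q i = (\<lambda>\<omega>. (whiten M S i *v v i) \<bullet> (S i \<omega> - sig_mean M S i))" if "i \<in> agents" for i
    by (simp add: q_def[abs_def] inner_whiten[OF info that])
  have q_aff: "q i \<in> affine_combs ?I ?X" if "i \<in> agents" for i
    unfolding q_eq[OF that] by (rule centered_signal_affine_comb[OF info that])
  have \<theta>_aff: "\<theta> \<in> affine_combs ?I ?X" using affine_combs_base[of None ?I ?X] by simp
  have q_sq: "square_integrable M (q i)" if "i \<in> agents" for i
    unfolding q_eq[OF that] by (rule centered_signal_square_integrable[OF info that])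
  have q_int: "integrable M (q i)" if "i \<in> agents" for i
    by (rule square_integrable_integrable[OF M q_sq[OF that]])
  have Eq: "expectation (q i) = 0" if "i \<in> agents" for i
    unfolding q_eq[OF that] by (rule expectation_centered_signal[OF info that])
  have cov_q: "cov M (q i) (q j) = v i \<bullet> (?P i j *v v j)" if "i \<in> agents" "j \<in> agents" for i j
    unfolding q_def[abs_def] by (rule cov_whitened_signals[OF info that])
  have cov_q\<theta>: "cov M (q i) \<theta> = h i * \<sigma>\<^sub>\<theta>\<^sup>2" if "i \<in> agents" for i
    unfolding q_def[abs_def] using cov_whitened_signal_state[OF info that] assms(1)
    by (simp add: h_def power2_eq_square)
  have cov_shift: "cov M (\<lambda>\<omega>. q i \<omega> + r) Y = cov M (q i) Y"
    if "i \<in> agents" "square_integrable M Y" for i r Y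
    using cov_affine_pair_left[OF M q_sq q_sq that(2), of i i r 1 0] that by (simp add: add.commute)
  have S'_aff: "(\<lambda>\<omega>. S' i \<omega> $ k) \<in> affine_combs ?I ?X" if "i \<in> agents" for i k
    unfolding S'_def vec_component by (intro affine_combs_add affine_combs_const q_aff that)
  have \<epsilon>_alt: "\<epsilon> i = (\<lambda>\<omega>. h i * \<mu>\<^sub>\<theta> + (1 * q i \<omega> + (- h i) * \<theta> \<omega>))" for i
    by (simp add: \<epsilon>_def[abs_def] algebra_simps)
  have \<epsilon>_aff: "\<epsilon> i \<in> affine_combs ?I ?X" if "i \<in> agents" for i
    unfolding \<epsilon>_alt
    by (intro affine_combs_add affine_combs_const affine_combs_mult q_aff \<theta>_aff that)
  have S'_sq: "square_integrable M (\<lambda>\<omega>. q i \<omega> + r)" if "i \<in> agents" for i r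
    using square_integrable_diff_const[OF M q_sq[OF that], of "-r"] by simp
  have S'_cov: "sig_cov M S' i j = mat (v i \<bullet> (?P i j *v v j))" if "i \<in> agents" "j \<in> agents" for i j
    using that
    by (simp add: sig_cov_def S'_def vec_eq_iff mat_def cov_shift S'_sq cov_commute[of M "q i" "\<lambda>\<omega>. q j \<omega> + _"] q_sq
        cov_commute[of M "q j" "q i"] cov_q forall_1)
  have S'_self: "sig_cov M S' i i = mat 1" if "i \<in> agents" for i
    using S'_cov[OF that that] corr_self[OF info that] v_norm[of i] by (simp add: norm_eq_1)
  \<comment> \<open>Unit variance makes whitening trivial, so correlations of the new signals are
    plain covariances.\<close>
  have whiten_S': "whiten M S' i = mat 1" if "i \<in> agents" for i
    unfolding whiten_def S'_self[OF that] matrix_sqrt_mat_1 by (rule matrix_inv_eqI) simp_all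
  have corr_S': "corr M S' i j = mat (v i \<bullet> (?P i j *v v j))" if "i \<in> agents" "j \<in> agents" for i j
    using that by (simp add: corr_def whiten_S' S'_cov)
  have state_corr_S': "state_corr \<sigma>\<^sub>\<theta> M \<theta> S' i = vec (v i \<bullet> ?p i)" if "i \<in> agents" for i
    using that assms(1)
    by (simp add: state_corr_def whiten_S' sig_state_cov_def S'_def vec_eq_iff cov_shift \<theta>_sq cov_q\<theta>
        h_def power2_eq_square)
  have mean_S': "sig_mean M S' i = vec (h i * \<mu>\<^sub>\<theta>)" if "i \<in> agents" for i
    using that by (simp add: sig_mean_def S'_def vec_eq_iff q_int Eq prob_space)

  \<comment> \<open>Measurability of the new correlations\<close>
  have corr_meas: "(\<lambda>(i, j). corr M S' i j $ k $ l) \<in> borel_measurable (lebesgue_on (agents \<times> agents))" for k l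
  proof -
    have [measurable]: "(\<lambda>x. v (fst x) $ k) \<in> borel_measurable (lebesgue_on (agents \<times> agents))"
      "(\<lambda>x. v (snd x) $ k) \<in> borel_measurable (lebesgue_on (agents \<times> agents))"
      "(\<lambda>x. ?P (fst x) (snd x) $ k $ l) \<in> borel_measurable (lebesgue_on (agents \<times> agents))" for k l
      using v_meas info
      by (auto simp: borel_measurable_vec_iff info_structure_def case_prod_unfold
          intro: lebesgue_on_Times_fst[of "\<lambda>i. v i $ k"] lebesgue_on_Times_snd[of "\<lambda>i. v i $ k"])
    have "(\<lambda>x. \<Sum>m\<in>UNIV. v (fst x) $ m * (\<Sum>n\<in>UNIV. ?P (fst x) (snd x) $ m $ n * v (snd x) $ n))
        \<in> borel_measurable (lebesgue_on (agents \<times> agents))"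
      by measurable
    \<comment> \<open>The index type has one element, so the zero off-diagonal case of
      \<open>mat\<close> never occurs.\<close>
    moreover have "k = l" by (rule trans[OF num1_eq1 num1_eq1[symmetric]])
    ultimately show ?thesis
      by (elim measurable_cong[THEN iffD1, rotated])
        (auto simp: corr_S' inner_vec_def matrix_vector_mult_def mat_def)
  qed
  have state_corr_meas: "(\<lambda>i. state_corr \<sigma>\<^sub>\<theta> M \<theta> S' i $ k) \<in> borel_measurable ?L" for k
  proof -
    have "(\<lambda>i. v i \<bullet> ?p i) \<in> borel_measurable ?L" by measurable
    then show ?thesis
      by (rule measurable_cong[THEN iffD1, rotated]) (auto simp: state_corr_S')
  qed

  \<comment> \<open>Verification of the canonical form\<close>
  have info': "info_structure \<mu>\<^sub>\<theta> \<sigma>\<^sub>\<theta> M \<theta> S'"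
    unfolding info_structure_def gaussian_with_state_def
  proof (intro conjI ballI allI \<theta>_dist corr_meas state_corr_meas)
    show "gaussian_process M (insert None (Some ` (agents \<times> UNIV))) (case_option \<theta> (\<lambda>(i, k) \<omega>. S' i \<omega> $ k))"
      by (rule gaussian_process_affine_combs[OF G]) (use \<theta>_aff S'_aff in auto)
    show "invertible (sig_cov M S' i i)" if "i \<in> agents" for i
      unfolding S'_self[OF that] invertible_def by (intro exI[of _ "mat 1"]) simp
  qed
  have "gaussian_with_state M \<theta> agents \<epsilon>"
    unfolding gaussian_with_state_def
    by (rule gaussian_process_affine_combs[OF G]) (use \<theta>_aff \<epsilon>_aff in auto)
  moreover have "expectation (\<epsilon> i) = 0" if "i \<in> agents" for i
    unfolding \<epsilon>_alt using that by (simp add: q_int \<theta>_int Eq E\<theta> prob_space)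
  moreover have "cov M (\<epsilon> i) \<theta> = 0" if "i \<in> agents" for i
    unfolding \<epsilon>_alt cov_affine_pair_left[OF M q_sq[OF that] \<theta>_sq \<theta>_sq]
    by (simp add: cov_q\<theta>[OF that] E\<theta>)
  moreover have "variance (\<lambda>\<omega>. S' i \<omega> $ 1) = 1" if "i \<in> agents" for i
    using arg_cong[OF S'_self[OF that], of "\<lambda>A. A $ 1 $ 1"]
    by (simp add: sig_cov_def cov_def mat_def power2_eq_square)
  moreover have "0 \<le> h i" for i using v_p assms(1) by (simp add: h_def)
  moreover have "S' i \<omega> $ 1 = h i * \<theta> \<omega> + \<epsilon> i \<omega>" for i \<omega>
    by (simp add: S'_def \<epsilon>_def algebra_simps)
  \<comment> \<open>The kernel \<open>g\<close> is taken to be the covariance of the noise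
    itself.\<close>
  ultimately have canonical: "canonical_info_structure \<mu>\<^sub>\<theta> \<sigma>\<^sub>\<theta> M \<theta> S'"
    unfolding canonical_info_structure_def using info'
    by (intro conjI exI[of _ h] exI[of _ "\<lambda>i j. cov M (\<epsilon> i) (\<epsilon> j)"] exI[of _ \<epsilon>]) auto

  \<comment> \<open>The scalar equilibrium equation\<close>
  have vec_scaleR: "(vec x :: real^1) = x *\<^sub>R vec 1" for x by (simp add: vec_eq_iff)
  have eq: "affine_equilibrium \<mu>\<^sub>\<theta> \<sigma>\<^sub>\<theta> w b c (corr M S') (state_corr \<sigma>\<^sub>\<theta> M \<theta> S') \<phi>\<^sub>0 \<phi>'"
    unfolding affine_equilibrium_def
  proof (intro conjI ballI allI)
    show "square_integrable_on (\<lambda>i. \<phi>' i $ k) agents" for k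
    proof -
      \<comment> \<open>Since \<open>v i\<close> is a unit vector along \<open>\<phi> i\<close>, the
        new coefficient squared is the squared norm of \<open>\<phi> i\<close>, a finite sum of
        integrable functions.\<close>
      have "(v i \<bullet> \<phi> i)\<^sup>2 = (\<Sum>k\<in>UNIV. (\<phi> i $ k)\<^sup>2)" for i
      proof -
        have "(v i \<bullet> \<phi> i)\<^sup>2 = (norm (\<phi> i))\<^sup>2"
          by (subst (2) \<phi>_eq) (simp add: v_norm)
        also have "\<dots> = (\<Sum>k\<in>UNIV. (\<phi> i $ k)\<^sup>2)"
          unfolding power2_norm_eq_inner by (simp add: inner_vec_def power2_eq_square)
        finally show ?thesis .
      qed
      moreover have "(\<lambda>i. v i \<bullet> \<phi> i) \<in> borel_measurable ?L" by measurable
      ultimately show ?thesis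
        using assms(4) by (auto simp: square_integrable_on_def \<phi>'_def affine_equilibrium_def)
    qed
    fix i assume i: "i \<in> agents"
    let ?f = "\<lambda>j. w i j *\<^sub>R (?P i j *v \<phi> j)"
    have int: "integrable ?L ?f" and fp: "\<phi> i = (LINT j|?L. ?f j) + (\<sigma>\<^sub>\<theta> * b i) *\<^sub>R ?p i"
      using assms(4) i by (auto simp: affine_equilibrium_def)
    \<comment> \<open>Decomposing \<open>\<phi> j\<close> along \<open>v j\<close> turns the
      \<open>v i\<close> component of the old integrand into the scalar correlation times the new
      coefficient.\<close>
    have cong: "w i j *\<^sub>R (corr M S' i j *v \<phi>' j) = (v i \<bullet> ?f j) *\<^sub>R vec 1" if "j \<in> space ?L" for j
    proof -
      have "v i \<bullet> (?P i j *v \<phi> j) = (v i \<bullet> (?P i j *v v j)) * (v j \<bullet> \<phi> j)"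
        by (subst \<phi>_eq) (simp add: matrix_vector_mult_scaleR)
      then show ?thesis using i that
        by (simp add: corr_S' \<phi>'_def matrix_1_vector_mult mat_def vec_eq_iff)
    qed
    have "integrable ?L (\<lambda>j. w i j *\<^sub>R (corr M S' i j *v \<phi>' j)) \<longleftrightarrow>
        integrable ?L (\<lambda>j. (v i \<bullet> ?f j) *\<^sub>R (vec 1 :: real^1))"
      by (intro Bochner_Integration.integrable_cong refl cong)
    then show "integrable ?L (\<lambda>j. w i j *\<^sub>R (corr M S' i j *v \<phi>' j))"
      using integrable_scaleR_left[OF integrable_inner_right[OF int]] by blast
    have "(LINT j|?L. w i j *\<^sub>R (corr M S' i j *v \<phi>' j)) =
        (LINT j|?L. (v i \<bullet> ?f j) *\<^sub>R (vec 1 :: real^1))"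
      by (intro Bochner_Integration.integral_cong refl cong)
    \<comment> \<open>For fixed \<open>i\<close> the vector \<open>v i\<close> is constant in
      \<open>j\<close>, so the inner product passes through the integral.\<close>
    also have "\<dots> = (v i \<bullet> (LINT j|?L. ?f j)) *\<^sub>R vec 1"
      using int by (simp del: inner_scaleR_right)
    finally have "(LINT j|?L. w i j *\<^sub>R (corr M S' i j *v \<phi>' j)) =
        (v i \<bullet> (LINT j|?L. ?f j)) *\<^sub>R vec 1" .
    moreover have "\<phi>' i = (v i \<bullet> ((LINT j|?L. ?f j) + (\<sigma>\<^sub>\<theta> * b i) *\<^sub>R ?p i)) *\<^sub>R vec 1"
      unfolding fp[symmetric] \<phi>'_def by (rule vec_scaleR)
    ultimately show "\<phi>' i = (LINT j|?L. w i j *\<^sub>R (corr M S' i j *v \<phi>' j)) +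
        (\<sigma>\<^sub>\<theta> * b i) *\<^sub>R state_corr \<sigma>\<^sub>\<theta> M \<theta> S' i"
      by (simp add: state_corr_S'[OF i] inner_add_right vec_eq_iff)
  qed (use assms(4) in \<open>auto simp: affine_equilibrium_def\<close>)

  \<comment> \<open>Coincidence of the outcomes\<close>
  have "outcome M S \<phi>\<^sub>0 \<phi> i \<omega> = outcome M S' \<phi>\<^sub>0 \<phi>' i \<omega>" if "i \<in> agents" for i \<omega>
  proof -
    have "\<phi> i \<bullet> (whiten M S i *v (S i \<omega> - sig_mean M S i)) = (v i \<bullet> \<phi> i) * q i \<omega>"
      unfolding q_def by (subst \<phi>_eq) simp
    then show ?thesis using that
      by (simp add: outcome_def whiten_S' mean_S' S'_def \<phi>'_def inner_vec_def)
  qed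
  \<comment> \<open>The law sees the action profile only through its restriction to
    \<open>agents\<close>, where the two outcomes agree pointwise; the state and the probability
    space are unchanged.\<close>
  then have "outcome_law M \<theta> (outcome M S \<phi>\<^sub>0 \<phi>) = outcome_law M \<theta> (outcome M S' \<phi>\<^sub>0 \<phi>')"
    unfolding outcome_law_def by (simp cong: restrict_cong)
  then show ?thesis using canonical eq by blast
qed

end
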